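(* Let $(X,\mathscr{E}_X)$ and $(Y,\mathscr{E}_Y)$ be coarse spaces. They are coarsely equivalent if and only if there exist coarse families of maps \[\mathcal{F}=\{f_L:L\to Y \mid L\in\mathbf{L}(\mathscr{E}_X)\}\quad\text{and}\quad \mathcal{G}=\{g_{L'}:L'\to X\mid L'\in\mathbf{L}(\mathscr{E}_Y)\}\] such that $\{(g_{f_L(L)}\circ f_L(x),x)\mid x\in L\}\in\mathscr{E}_X$ for every $L\in\mathbf{L}(\mathscr{E}_X)$ and $\{(f_{g_{L'}(L')}\circ g_{L'}(y),y)\mid y\in L'\}\in\mathscr{E}_Y$ for every $L'\in\mathbf{L}(\mathscr{E}_Y)$.
   Context: For $E,F\subseteq X\times X$ let $E^{-1}=\{(y,x):(x,y)\in E\}$ and $E\circ F=\{(x,z):\exists y,\ (x,y)\in E,\ (y,z)\in F\}$. A coarse structure on a set $X$ is a collection $\mathscr{E}$ of subsets of $X\times X$ closed under inverses, products $\circ$, finite unions and subsets, and containing every finite subset of $X\times X$ (the diagonal is not required to belong to $\mathscr{E}$); $(X,\mathscr{E})$ is then a coarse space. The coarse structure generated by a family of subsets is the smallest one containing it. For $A,B\subseteq X$, $\mathscr{E}|_{A\times B}=\{E\cap(A\times B): E\in\mathscr{E}\}$. Coarse equivalence: a coarse correspondence from $(X,\mathscr{E}_X)$ to $(Y,\mathscr{E}_Y)$ is a coarse structure $\mathscr{E}$ on $X\sqcup Y$ with $\mathscr{E}|_{Y\times Y}=\mathscr{E}_Y$, $\mathscr{E}|_{X\times X}\supseteq\mathscr{E}_X$,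 and $\mathscr{E}$ generated by $\mathscr{E}|_{Y\times(X\sqcup Y)}$. A coarse equivalence is a coarse structure on $X\sqcup Y$ that is a coarse correspondence both from $X$ to $Y$ and from $Y$ to $X$; the spaces are coarsely equivalent if one exists. $\mathbf{L}(\mathscr{E}_X)=\{\mathrm{r}(E):E\in\mathscr{E}_X\}$, with $\mathrm{r}$ the projection to the first coordinate; equivalently the collection of $L\subseteq X$ with $\{(x,x):x\in L\}\in\mathscr{E}_X$. Coarse families: a family $\mathcal{F}=\{f_L:L\to Y\mid L\in\mathbf{L}(\mathscr{E}_X)\}$ is admissible if for all $L_1,L_2\in\mathbf{L}(\mathscr{E}_X)$ the set $\{(f_{L_1}(x),f_{L_2}(x)):x\in L_1\cap L_2\}$ belongs to $\mathscr{E}_Y$ (this implies $f_L(L)\in\mathbf{L}(\mathscr{E}_Y)$ for all $L$). It is coarse if it is admissible and $\mathscr{E}_X\subseteq\mathcal{F}^*\mathscr{E}_Y$, where $\mathcal{F}^*\mathscr{E}_Y$ is the collection of all $E\subseteq X\times X$ for which there is $L\in\mathbf{L}(\mathscr{E}_X)$ with $E\subseteq L\times L$ and $(f_L\times f_L)(E)\in\mathscr{E}_Y$. The definitions for $\mathcal{G}$ are the same with the roles of $X$ and $Y$ exchanged.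
   Formalization: The formal statement assumes that X is empty if and only if Y is empty; without this the claim fails, e.g. for X a single point and Y empty, which are coarsely equivalent although no map from X to Y exists. *)

theory Defs
  imports Main
begin

(* Coarse structures are taken on a carrier set X. The diagonal of X need not be controlled.
   The composition (O) of relations is the product of the coarse structure, in the same order. *)
definition coarse_structure :: "'a set \<Rightarrow> ('a \<times> 'a) set set \<Rightarrow> bool" where
  "coarse_structure X \<E> \<longleftrightarrow>
     \<E> \<subseteq> Pow (X \<times> X) \<and>
     (\<forall>E\<in>\<E>. E\<inverse> \<in> \<E>) \<and>
     (\<forall>E\<in>\<E>. \<forall>F\<in>\<E>. E O F \<in> \<E>) \<and>
     (\<forall>E\<in>\<E>. \<forall>F\<in>\<E>. E \<union> F \<in> \<E>) \<and>
     (\<forall>E\<in>\<E>. \<forall>F. F \<subseteq> E \<longrightarrow> F \<in> \<E>) \<and>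
     (\<forall>F. finite F \<and> F \<subseteq> X \<times> X \<longrightarrow> F \<in> \<E>)"

definition generated_coarse_structure ::
    "'a set \<Rightarrow> ('a \<times> 'a) set set \<Rightarrow> ('a \<times> 'a) set set" where
  "generated_coarse_structure X \<S> = \<Inter> {\<E>. coarse_structure X \<E> \<and> \<S> \<subseteq> \<E>}"

definition restrict_coarse ::
    "('a \<times> 'a) set set \<Rightarrow> 'a set \<Rightarrow> 'a set \<Rightarrow> ('a \<times> 'a) set set" where
  "restrict_coarse \<E> A B = (\<lambda>E. E \<inter> (A \<times> B)) ` \<E>"

(* Coarse correspondence from (A, \<E>A) to (B, \<E>B), for disjoint sets A and B of a common type,
   so that the disjoint union of A and B is A \<union> B. Arbitrary X and Y are made disjoint
   by Inl and Inr, see coarse_equivalence below. *)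
definition coarse_correspondence ::
    "'c set \<Rightarrow> ('c \<times> 'c) set set \<Rightarrow> 'c set \<Rightarrow> ('c \<times> 'c) set set \<Rightarrow> ('c \<times> 'c) set set \<Rightarrow> bool" where
  "coarse_correspondence A \<E>A B \<E>B \<E> \<longleftrightarrow>
     A \<inter> B = {} \<and>
     coarse_structure (A \<union> B) \<E> \<and>
     restrict_coarse \<E> B B = \<E>B \<and>
     \<E>A \<subseteq> restrict_coarse \<E> A A \<and>
     \<E> = generated_coarse_structure (A \<union> B) (restrict_coarse \<E> B (A \<union> B))"

definition transport_coarse :: "('a \<Rightarrow> 'c) \<Rightarrow> ('a \<times> 'a) set set \<Rightarrow> ('c \<times> 'c) set set" where
  "transport_coarse i \<E> = (\<lambda>E. map_prod i i ` E) ` \<E>"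

definition coarse_equivalence ::
    "'a set \<Rightarrow> ('a \<times> 'a) set set \<Rightarrow> 'b set \<Rightarrow> ('b \<times> 'b) set set \<Rightarrow>
     (('a + 'b) \<times> ('a + 'b)) set set \<Rightarrow> bool" where
  "coarse_equivalence X \<E>X Y \<E>Y \<E> \<longleftrightarrow>
     coarse_correspondence (Inl ` X) (transport_coarse Inl \<E>X) (Inr ` Y) (transport_coarse Inr \<E>Y) \<E> \<and>
     coarse_correspondence (Inr ` Y) (transport_coarse Inr \<E>Y) (Inl ` X) (transport_coarse Inl \<E>X) \<E>"

definition coarsely_equivalent ::
    "'a set \<Rightarrow> ('a \<times> 'a) set set \<Rightarrow> 'b set \<Rightarrow> ('b \<times> 'b) set set \<Rightarrow> bool" where
  "coarsely_equivalent X \<E>X Y \<E>Y \<longleftrightarrow> (\<exists>\<E>. coarse_equivalence X \<E>X Y \<E>Y \<E>)"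

definition coarse_sets :: "('a \<times> 'a) set set \<Rightarrow> 'a set set" where
  "coarse_sets \<E> = Domain ` \<E>"

(* A family of maps indexed by coarse_sets \<E>X is a function f of type 'a set \<Rightarrow> 'a \<Rightarrow> 'b. Only the
   values f L x with L \<in> coarse_sets \<E>X and x \<in> L are meaningful; the definitions below
   do not look at any others. *)
definition admissible_family ::
    "('a \<times> 'a) set set \<Rightarrow> 'b set \<Rightarrow> ('b \<times> 'b) set set \<Rightarrow> ('a set \<Rightarrow> 'a \<Rightarrow> 'b) \<Rightarrow> bool" where
  "admissible_family \<E>X Y \<E>Y f \<longleftrightarrow>
     (\<forall>L\<in>coarse_sets \<E>X. f L ` L \<subseteq> Y) \<and>
     (\<forall>L1\<in>coarse_sets \<E>X. \<forall>L2\<in>coarse_sets \<E>X. {(f L1 x, f L2 x) |x. x \<in> L1 \<inter> L2} \<in> \<E>Y)"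

definition pullback_coarse ::
    "'a set \<Rightarrow> ('a \<times> 'a) set set \<Rightarrow> ('b \<times> 'b) set set \<Rightarrow> ('a set \<Rightarrow> 'a \<Rightarrow> 'b) \<Rightarrow> ('a \<times> 'a) set set" where
  "pullback_coarse X \<E>X \<E>Y f =
     {E. E \<subseteq> X \<times> X \<and> (\<exists>L\<in>coarse_sets \<E>X. E \<subseteq> L \<times> L \<and> map_prod (f L) (f L) ` E \<in> \<E>Y)}"

(* With X nonempty and Y empty there is no map from a nonempty L to Y, hence no coarse family,
   although X with its finite subsets as coarse structure is coarsely equivalent to the empty
   space: every coarse structure contains the finite subsets. A characterization of coarse
   equivalence by coarse families therefore has to exclude that exactly one space is empty. *)
definition coarse_family ::
    "'a set \<Rightarrow> ('a \<times> 'a) set set \<Rightarrow> 'b set \<Rightarrow> ('b \<times> 'b) set set \<Rightarrow> ('a set \<Rightarrow> 'a \<Rightarrow> 'b) \<Rightarrow> bool" where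
  "coarse_family X \<E>X Y \<E>Y f \<longleftrightarrow>
     admissible_family \<E>X Y \<E>Y f \<and> \<E>X \<subseteq> pullback_coarse X \<E>X \<E>Y f"

end

theory Submission
  imports Defs
begin

text \<open>
  A coarse equivalence \<open>\<E>\<close> on \<open>X \<squnion> Y\<close> and a pair of coarse families carry the same information
  for the following reason. The condition that \<open>\<E>\<close> is generated by its restriction to
  \<open>Y \<times> (X \<squnion> Y)\<close> only says that every coarse set \<open>L\<close> of \<open>\<E>\<close> is \<open>\<E>\<close>-close to a part of \<open>Y\<close>: some
  \<open>H \<in> \<E>\<close> with first coordinates in \<open>Y\<close> has \<open>L\<close> among its second coordinates (lemma
  \<open>generated_by_restriction_iff\<close>). Relations with such supports form a coarse structure,
  and a relation \<open>E\<close> supported on \<open>L\<close> is recovered from the part over \<open>Y\<close> because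
  \<open>E \<subseteq> H\<inverse> \<circ> (H \<circ> E \<circ> H\<inverse>) \<circ> H\<close>.

  Given \<open>\<E>\<close>, choosing one partner in \<open>Y\<close> for each point of \<open>L\<close> yields \<open>f\<^sub>L : L \<rightarrow> Y\<close> whose graph
  lies in \<open>\<E>\<close> (lemma \<open>correspondence_selects_family\<close>), and \<open>g\<close> arises in the same way. All
  closeness conditions on the families then say that a composite of graphs and given
  controlled sets is controlled, which is closure of \<open>\<E>\<close> under products.

  Given the families, let \<open>\<E>\<close> be the pullback of \<open>\<E>\<^sub>Y\<close> along the family \<open>f\<^sub>L \<squnion> id : L \<squnion> Y \<rightarrow> Y\<close>
  (definition \<open>glued_coarse\<close>). It restricts to \<open>\<E>\<^sub>Y\<close> on \<open>Y\<close> by construction. It restricts to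
  \<open>\<E>\<^sub>X\<close> on \<open>X\<close> because a coarse family with a left inverse up to closeness induces exactly
  the given structure (lemma \<open>pullback_eq_of_left_inverse\<close>). It contains the graph of
  each \<open>f\<^sub>L\<close> by admissibility and that of each \<open>g\<^sub>L\<close> because \<open>f \<circ> g\<close> is close to the identity; these
  graphs are the sets \<open>H\<close> that the two generation conditions ask for.
\<close>

section \<open>Coarse structures and their coarse sets\<close>

context
  fixes X :: "'a set" and \<E> :: "('a \<times> 'a) set set"
  assumes coarse: "coarse_structure X \<E>"
begin

lemma coarse_carrier: "E \<in> \<E> \<Longrightarrow> E \<subseteq> X \<times> X"
  using coarse unfolding coarse_structure_def by (elim conjE) (drule (1) subsetD, erule PowD)

lemma coarse_converse: "E \<in> \<E> \<Longrightarrow> E\<inverse> \<in> \<E>"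
  using coarse by (simp add: coarse_structure_def)

lemma coarse_comp: "E \<in> \<E> \<Longrightarrow> F \<in> \<E> \<Longrightarrow> E O F \<in> \<E>"
  using coarse by (simp add: coarse_structure_def)

lemma coarse_Un: "E \<in> \<E> \<Longrightarrow> F \<in> \<E> \<Longrightarrow> E \<union> F \<in> \<E>"
  using coarse by (simp add: coarse_structure_def)

lemma coarse_subset: "E \<in> \<E> \<Longrightarrow> F \<subseteq> E \<Longrightarrow> F \<in> \<E>"
  using coarse by (simp add: coarse_structure_def)

lemma coarse_finite: "finite F \<Longrightarrow> F \<subseteq> X \<times> X \<Longrightarrow> F \<in> \<E>"
  using coarse by (simp add: coarse_structure_def)

lemma coarse_set_iff: "L \<in> coarse_sets \<E> \<longleftrightarrow> Id_on L \<in> \<E>"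
proof
  assume "L \<in> coarse_sets \<E>"
  then obtain E where E: "E \<in> \<E>" "L = Domain E" by (auto simp: coarse_sets_def)
  have "Id_on L \<subseteq> E O E\<inverse>" using E(2) by auto
  with coarse_comp[OF E(1) coarse_converse[OF E(1)]] show "Id_on L \<in> \<E>"
    by (rule coarse_subset)
next
  assume "Id_on L \<in> \<E>"
  then show "L \<in> coarse_sets \<E>"
    unfolding coarse_sets_def by (rule rev_image_eqI) simp
qed

lemma coarse_set_Un: "L \<in> coarse_sets \<E> \<Longrightarrow> M \<in> coarse_sets \<E> \<Longrightarrow> L \<union> M \<in> coarse_sets \<E>"
  unfolding coarse_set_iff by (drule (1) coarse_Un, erule coarse_subset) auto

lemma coarse_set_finite: "finite L \<Longrightarrow> L \<subseteq> X \<Longrightarrow> L \<in> coarse_sets \<E>"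
  unfolding coarse_set_iff by (rule coarse_finite) (auto simp: Id_on_def)

lemma coarse_set_carrier: "L \<in> coarse_sets \<E> \<Longrightarrow> L \<subseteq> X"
  unfolding coarse_set_iff by (drule coarse_carrier) auto

lemma Domain_coarse_set: "E \<in> \<E> \<Longrightarrow> Domain E \<in> coarse_sets \<E>"
  by (simp add: coarse_sets_def)

lemma Range_coarse_set: "E \<in> \<E> \<Longrightarrow> Range E \<in> coarse_sets \<E>"
  using Domain_coarse_set[OF coarse_converse] by simp

lemma Field_coarse_set: "E \<in> \<E> \<Longrightarrow> Field E \<in> coarse_sets \<E>"
  by (simp add: Field_def coarse_set_Un Domain_coarse_set Range_coarse_set)

end

section \<open>Generation by the relations starting in a subset\<close>

text \<open>
  For the forward direction, the controlled sets whose field is covered in the stated way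
  form a coarse structure containing the generators. Finite sets are covered by joining
  their points to a single point of \<open>B\<close>, which is where nonemptiness of \<open>B\<close> enters.
\<close>

lemma generated_by_restriction_iff:
  assumes Z: "coarse_structure Z \<E>" and B: "B \<subseteq> Z" and ne: "B = {} \<Longrightarrow> Z = {}"
  shows "\<E> = generated_coarse_structure Z (restrict_coarse \<E> B Z) \<longleftrightarrow>
    (\<forall>L\<in>coarse_sets \<E>. \<exists>H\<in>\<E>. Domain H \<subseteq> B \<and> L \<subseteq> Range H)"
    (is "?gen \<longleftrightarrow> ?cover")
proof
  assume gen: ?gen
  define \<C> where "\<C> = {E\<in>\<E>. \<exists>H\<in>\<E>. Domain H \<subseteq> B \<and> Field E \<subseteq> Range H}"
  have join: "\<exists>H\<in>\<E>. Domain H \<subseteq> B \<and> L \<subseteq> Range H"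
    if "H1 \<in> \<E>" "Domain H1 \<subseteq> B" "H2 \<in> \<E>" "Domain H2 \<subseteq> B" "L \<subseteq> Range H1 \<union> Range H2"
    for H1 H2 and L :: "'a set"
    using that by (intro bexI[of _ "H1 \<union> H2"]) (auto intro: coarse_Un[OF Z])
  have "coarse_structure Z \<C>"
    unfolding coarse_structure_def
  proof (intro conjI ballI allI impI)
    show "\<C> \<subseteq> Pow (Z \<times> Z)"
      using coarse_carrier[OF Z] by (auto simp: \<C>_def)
  next
    fix E assume "E \<in> \<C>"
    then show "E\<inverse> \<in> \<C>"
      by (auto simp: \<C>_def Field_converse intro: coarse_converse[OF Z])
  next
    fix E F assume EF: "E \<in> \<C>" "F \<in> \<C>"
    then have EF': "E \<in> \<E>" "F \<in> \<E>" by (simp_all add: \<C>_def)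
    from EF obtain H1 H2 where H: "H1 \<in> \<E>" "Domain H1 \<subseteq> B" "Field E \<subseteq> Range H1"
      "H2 \<in> \<E>" "Domain H2 \<subseteq> B" "Field F \<subseteq> Range H2"
      by (auto simp: \<C>_def)
    have "Field (E O F) \<subseteq> Range H1 \<union> Range H2"
      using H(3,6) by (auto simp: Field_def)
    from join[OF H(1,2,4,5) this] show "E O F \<in> \<C>"
      using coarse_comp[OF Z EF'] by (simp add: \<C>_def)
    have "Field (E \<union> F) \<subseteq> Range H1 \<union> Range H2"
      using H(3,6) by (auto simp: Field_def)
    from join[OF H(1,2,4,5) this] show "E \<union> F \<in> \<C>"
      using coarse_Un[OF Z EF'] by (simp add: \<C>_def)
  next
    fix E F :: "('a \<times> 'a) set" assume EF: "E \<in> \<C>" "F \<subseteq> E"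
    then obtain H where H: "H \<in> \<E>" "Domain H \<subseteq> B" "Field E \<subseteq> Range H" by (auto simp: \<C>_def)
    moreover have "Field F \<subseteq> Range H" using mono_Field[OF EF(2)] H(3) by (rule order_trans)
    moreover have "F \<in> \<E>" using EF coarse_subset[OF Z, of E F] by (simp add: \<C>_def)
    ultimately show "F \<in> \<C>" unfolding \<C>_def by blast
  next
    fix F :: "('a \<times> 'a) set" assume F: "finite F \<and> F \<subseteq> Z \<times> Z"
    then have FE: "F \<in> \<E>" using coarse_finite[OF Z] by blast
    show "F \<in> \<C>"
    proof (cases "B = {}")
      case True
      then have "F = {}" using ne F by blast
      then show ?thesis using FE by (auto simp: \<C>_def intro: bexI[of _ F])
    next
      case False
      then obtain b where b: "b \<in> B" by blast
      have "{b} \<times> Field F \<in> \<E>"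
        using F b B by (intro coarse_finite[OF Z]) (auto simp: Field_def finite_Domain finite_Range)
      then show ?thesis
        using FE b by (auto simp: \<C>_def intro!: bexI[of _ "{b} \<times> Field F"])
    qed
  qed
  moreover have "restrict_coarse \<E> B Z \<subseteq> \<C>"
  proof
    fix E assume "E \<in> restrict_coarse \<E> B Z"
    then have E: "E \<in> \<E>" "Domain E \<subseteq> B"
      by (auto simp: restrict_coarse_def intro: coarse_subset[OF Z])
    have "\<exists>H\<in>\<E>. Domain H \<subseteq> B \<and> Field E \<subseteq> Range H"
      \<comment> \<open>the second coordinates of \<open>E \<circ> E\<inverse>\<close> are the first coordinates of \<open>E\<close>\<close>
      using E by (intro join[of E "E O E\<inverse>"])
        (auto simp: Field_def intro: coarse_comp[OF Z] coarse_converse[OF Z])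
    then show "E \<in> \<C>" using E by (simp add: \<C>_def)
  qed
  ultimately have "\<E> \<subseteq> \<C>"
    by (subst gen) (auto simp: generated_coarse_structure_def)
  show ?cover
  proof
    fix L assume "L \<in> coarse_sets \<E>"
    then have "Id_on L \<in> \<C>" using \<open>\<E> \<subseteq> \<C>\<close> coarse_set_iff[OF Z] by blast
    then show "\<exists>H\<in>\<E>. Domain H \<subseteq> B \<and> L \<subseteq> Range H"
      by (auto simp: \<C>_def Field_def)
  qed
next
  assume cover: ?cover
  have "restrict_coarse \<E> B Z \<subseteq> \<E>"
    by (auto simp: restrict_coarse_def intro: coarse_subset[OF Z])
  then have "generated_coarse_structure Z (restrict_coarse \<E> B Z) \<subseteq> \<E>"
    using Z by (auto simp: generated_coarse_structure_def)
  moreover have "E \<in> \<D>"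
    if E: "E \<in> \<E>" and D: "coarse_structure Z \<D>" and gens: "restrict_coarse \<E> B Z \<subseteq> \<D>"
    for E \<D>
  proof -
    obtain H where H: "H \<in> \<E>" "Domain H \<subseteq> B" "Field E \<subseteq> Range H"
      using bspec[OF cover Field_coarse_set[OF Z E]] by blast
    have gen: "F \<in> \<D>" if "F \<in> \<E>" "Domain F \<subseteq> B" for F
    proof -
      have "F = F \<inter> (B \<times> Z)" using that coarse_carrier[OF Z that(1)] by auto
      then have "F \<in> restrict_coarse \<E> B Z"
        unfolding restrict_coarse_def using that(1) by (rule image_eqI)
      then show ?thesis using gens by blast
    qed
    have "H O E O H\<inverse> \<in> \<D>"
      using H E by (intro gen coarse_comp[OF Z] coarse_converse[OF Z]) auto
    then have "H\<inverse> O (H O E O H\<inverse>) O H \<in> \<D>"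
      using gen[OF H(1,2)] by (metis coarse_comp[OF D] coarse_converse[OF D])
    moreover have "E \<subseteq> H\<inverse> O (H O E O H\<inverse>) O H"
    proof clarify
      fix x y assume xy: "(x, y) \<in> E"
      then have "x \<in> Range H" "y \<in> Range H" using H(3) by (auto simp: Field_def)
      with xy show "(x, y) \<in> H\<inverse> O (H O E O H\<inverse>) O H" by blast
    qed
    ultimately show "E \<in> \<D>" by (rule coarse_subset[OF D])
  qed
  ultimately show ?gen
    unfolding generated_coarse_structure_def by blast
qed

text \<open>
  Turns the equation between collections of sets into a membership rule that can be applied to
  single relations, in either direction.
\<close>

lemma restrict_eq_transport_iff:
  assumes "inj i" and Z: "coarse_structure Z \<E>" and D: "\<D> \<subseteq> Pow (X \<times> X)"
  shows "restrict_coarse \<E> (i ` X) (i ` X) = transport_coarse i \<D> \<longleftrightarrow>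
    (\<forall>E. E \<in> \<D> \<longleftrightarrow> E \<subseteq> X \<times> X \<and> map_prod i i ` E \<in> \<E>)"
proof -
  have "inj (map_prod i i)" using \<open>inj i\<close> by (simp add: prod.inj_map)
  then have inj: "inj ((`) (map_prod i i))"
    by (simp add: inj_on_def inj_image_eq_iff)
  have "F \<in> restrict_coarse \<E> (i ` X) (i ` X) \<longleftrightarrow> F \<in> \<E> \<and> F \<subseteq> i ` X \<times> i ` X" for F
  proof
    assume "F \<in> restrict_coarse \<E> (i ` X) (i ` X)"
    then obtain E where "E \<in> \<E>" "F = E \<inter> (i ` X \<times> i ` X)"
      by (auto simp: restrict_coarse_def)
    then show "F \<in> \<E> \<and> F \<subseteq> i ` X \<times> i ` X" using coarse_subset[OF Z, of E F] by blast
  next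
    assume F: "F \<in> \<E> \<and> F \<subseteq> i ` X \<times> i ` X"
    then have "F = F \<inter> (i ` X \<times> i ` X)" by blast
    with F show "F \<in> restrict_coarse \<E> (i ` X) (i ` X)"
      unfolding restrict_coarse_def by blast
  qed
  moreover have "i ` X \<times> i ` X = map_prod i i ` (X \<times> X)"
    by auto
  ultimately have "restrict_coarse \<E> (i ` X) (i ` X) =
      (`) (map_prod i i) ` {E. E \<subseteq> X \<times> X \<and> map_prod i i ` E \<in> \<E>}"
    by (auto simp: subset_image_iff set_eq_iff[of "restrict_coarse _ _ _"])
  then have "restrict_coarse \<E> (i ` X) (i ` X) = transport_coarse i \<D> \<longleftrightarrow>
      {E. E \<subseteq> X \<times> X \<and> map_prod i i ` E \<in> \<E>} = \<D>"
    by (simp add: transport_coarse_def inj_image_eq_iff[OF inj])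
  then show ?thesis
    by (simp only: set_eq_iff mem_Collect_eq) blast
qed

section \<open>From a coarse equivalence to coarse families\<close>

text \<open>
  The injections \<open>i\<close> and \<open>j\<close> stand for the two summands, so that the lemma yields both \<open>f\<close>
  and \<open>g\<close>. For each coarse set \<open>L\<close> of \<open>X\<close>, the map picks for \<open>x \<in> L\<close> a point of \<open>Y\<close> related
  to it by one controlled set that covers \<open>L\<close>.
\<close>

lemma correspondence_selects_family:
  assumes X: "coarse_structure X \<E>X"
    and corr: "coarse_correspondence (i ` X) (transport_coarse i \<E>X) (j ` Y) \<E>B \<E>"
    and ne: "Y = {} \<Longrightarrow> X = {}"
  shows "\<exists>f. \<forall>L\<in>coarse_sets \<E>X. f L ` L \<subseteq> Y \<and> {(j (f L x), i x) |x. x \<in> L} \<in> \<E>"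
proof -
  define Z where "Z = i ` X \<union> j ` Y"
  have Z: "coarse_structure Z \<E>"
    and sub: "transport_coarse i \<E>X \<subseteq> restrict_coarse \<E> (i ` X) (i ` X)"
    and gen: "\<E> = generated_coarse_structure Z (restrict_coarse \<E> (j ` Y) Z)"
    using corr unfolding coarse_correspondence_def Z_def by auto
  have cover: "\<forall>L\<in>coarse_sets \<E>. \<exists>H\<in>\<E>. Domain H \<subseteq> j ` Y \<and> L \<subseteq> Range H"
    using gen ne by (subst (asm) generated_by_restriction_iff[OF Z]) (auto simp: Z_def)
  have "\<exists>h. h ` L \<subseteq> Y \<and> {(j (h x), i x) |x. x \<in> L} \<in> \<E>" if L: "L \<in> coarse_sets \<E>X" for L
  proof -
    have "map_prod i i ` Id_on L \<in> restrict_coarse \<E> (i ` X) (i ` X)"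
      using sub L by (auto simp: transport_coarse_def coarse_set_iff[OF X])
    then have "map_prod i i ` Id_on L \<in> \<E>"
      by (auto simp: restrict_coarse_def intro: coarse_subset[OF Z])
    moreover have "map_prod i i ` Id_on L = Id_on (i ` L)" by force
    ultimately have iL: "i ` L \<in> coarse_sets \<E>" by (simp add: coarse_set_iff[OF Z])
    obtain H where H: "H \<in> \<E>" "Domain H \<subseteq> j ` Y" "i ` L \<subseteq> Range H"
      using bspec[OF cover iL] by blast
    have "\<forall>x\<in>L. \<exists>y. y \<in> Y \<and> (j y, i x) \<in> H"
    proof
      fix x assume "x \<in> L"
      then obtain z where "(z, i x) \<in> H" using H(3) by blast
      then show "\<exists>y. y \<in> Y \<and> (j y, i x) \<in> H" using H(2) by blast
    qed
    then obtain h where h: "\<forall>x\<in>L. h x \<in> Y \<and> (j (h x), i x) \<in> H"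
      by metis
    then show ?thesis
      by (intro exI[of _ h]) (auto intro: coarse_subset[OF Z H(1)])
  qed
  then show ?thesis by (intro bchoice ballI)
qed

text \<open>
  With \<open>F\<^sub>L\<close> the graph of \<open>f\<^sub>L\<close>, read as pairs \<open>(f\<^sub>L x, x)\<close>, closeness of two members of the family
  is control of \<open>F\<^sub>L \<circ> F\<^sub>M\<inverse>\<close>, and the image of a relation \<open>E\<close> on \<open>L\<close> is \<open>F\<^sub>L \<circ> E \<circ> F\<^sub>L\<inverse>\<close>. Both products
  are formed in \<open>\<E>\<close> and land in \<open>Y \<times> Y\<close>.
\<close>

lemma selected_family_coarse:
  assumes X: "coarse_structure X \<E>X" and Z: "coarse_structure Z \<E>"
    and EX: "\<And>E. E \<in> \<E>X \<Longrightarrow> map_prod i i ` E \<in> \<E>"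
    and EY: "\<And>E. E \<subseteq> Y \<times> Y \<Longrightarrow> map_prod j j ` E \<in> \<E> \<Longrightarrow> E \<in> \<E>Y"
    and f: "\<And>L. L \<in> coarse_sets \<E>X \<Longrightarrow> f L ` L \<subseteq> Y"
    and graph: "\<And>L. L \<in> coarse_sets \<E>X \<Longrightarrow> {(j (f L x), i x) |x. x \<in> L} \<in> \<E>"
  shows "coarse_family X \<E>X Y \<E>Y f"
proof -
  have "{(f L1 x, f L2 x) |x. x \<in> L1 \<inter> L2} \<in> \<E>Y"
    if L: "L1 \<in> coarse_sets \<E>X" "L2 \<in> coarse_sets \<E>X" for L1 L2
  proof (rule EY)
    show "{(f L1 x, f L2 x) |x. x \<in> L1 \<inter> L2} \<subseteq> Y \<times> Y"
      using f[OF L(1)] f[OF L(2)] by blast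
    show "map_prod j j ` {(f L1 x, f L2 x) |x. x \<in> L1 \<inter> L2} \<in> \<E>"
      by (rule coarse_subset[OF Z coarse_comp[OF Z graph[OF L(1)]
            coarse_converse[OF Z graph[OF L(2)]]]]) auto
  qed
  moreover have "\<exists>L\<in>coarse_sets \<E>X. E \<subseteq> L \<times> L \<and> map_prod (f L) (f L) ` E \<in> \<E>Y"
    if E: "E \<in> \<E>X" for E
  proof (intro bexI conjI)
    let ?L = "Field E"
    show L: "?L \<in> coarse_sets \<E>X" by (rule Field_coarse_set[OF X E])
    show EL: "E \<subseteq> ?L \<times> ?L" by (auto simp: Field_def)
    show "map_prod (f ?L) (f ?L) ` E \<in> \<E>Y"
    proof (rule EY)
      show "map_prod (f ?L) (f ?L) ` E \<subseteq> Y \<times> Y"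
        using f[OF L] EL by fastforce
      let ?F = "{(j (f ?L x), i x) |x. x \<in> ?L}"
      have "?F O map_prod i i ` E O ?F\<inverse> \<in> \<E>"
        by (intro coarse_comp[OF Z] coarse_converse[OF Z] graph[OF L] EX[OF E])
      moreover have "map_prod j j ` map_prod (f ?L) (f ?L) ` E \<subseteq> ?F O map_prod i i ` E O ?F\<inverse>"
      proof clarsimp
        fix x y assume xy: "(x, y) \<in> E"
        then have "x \<in> ?L" "y \<in> ?L" by (auto simp: Field_def)
        then have "(j (f ?L x), i x) \<in> ?F" "(i y, j (f ?L y)) \<in> ?F\<inverse>" by auto
        moreover have "(i x, i y) \<in> map_prod i i ` E" using xy by force
        ultimately show "(j (f ?L x), j (f ?L y)) \<in> ?F O map_prod i i ` E O ?F\<inverse>"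
          by - (intro relcompI; assumption)
      qed
      ultimately show "map_prod j j ` map_prod (f ?L) (f ?L) ` E \<in> \<E>"
        by (rule coarse_subset[OF Z])
    qed
  qed
  ultimately show ?thesis
    unfolding coarse_family_def admissible_family_def pullback_coarse_def
    using f coarse_carrier[OF X] by (intro conjI ballI subsetI[of \<E>X] CollectI)
qed

lemma selected_image_coarse_set:
  assumes Y: "coarse_structure Y \<E>Y" and Z: "coarse_structure Z \<E>"
    and EY: "\<And>E. E \<subseteq> Y \<times> Y \<Longrightarrow> map_prod j j ` E \<in> \<E> \<Longrightarrow> E \<in> \<E>Y"
    and "h ` L \<subseteq> Y" and graph: "{(j (h x), i x) |x. x \<in> L} \<in> \<E>"
  shows "h ` L \<in> coarse_sets \<E>Y"
  unfolding coarse_set_iff[OF Y]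
proof (rule EY)
  show "Id_on (h ` L) \<subseteq> Y \<times> Y" using assms(4) by auto
  show "map_prod j j ` Id_on (h ` L) \<in> \<E>"
    by (rule coarse_subset[OF Z coarse_comp[OF Z graph coarse_converse[OF Z graph]]]) auto
qed

text \<open>The graphs of \<open>f\<^sub>L\<close> and \<open>g\<^sub>M\<close>, \<open>M = f\<^sub>L(L)\<close>, compose to the relation of closeness to the identity.\<close>

lemma selected_families_inverse:
  assumes X: "coarse_structure X \<E>X" and Y: "coarse_structure Y \<E>Y" and Z: "coarse_structure Z \<E>"
    and EX: "\<And>E. E \<subseteq> X \<times> X \<Longrightarrow> map_prod i i ` E \<in> \<E> \<Longrightarrow> E \<in> \<E>X"
    and EY: "\<And>E. E \<subseteq> Y \<times> Y \<Longrightarrow> map_prod j j ` E \<in> \<E> \<Longrightarrow> E \<in> \<E>Y"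
    and f: "\<And>L. L \<in> coarse_sets \<E>X \<Longrightarrow> f L ` L \<subseteq> Y \<and> {(j (f L x), i x) |x. x \<in> L} \<in> \<E>"
    and g: "\<And>L. L \<in> coarse_sets \<E>Y \<Longrightarrow> g L ` L \<subseteq> X \<and> {(i (g L y), j y) |y. y \<in> L} \<in> \<E>"
    and L: "L \<in> coarse_sets \<E>X"
  shows "{(g (f L ` L) (f L x), x) |x. x \<in> L} \<in> \<E>X"
proof (rule EX)
  have M: "f L ` L \<in> coarse_sets \<E>Y"
    using f[OF L] selected_image_coarse_set[OF Y Z EY] by blast
  show "{(g (f L ` L) (f L x), x) |x. x \<in> L} \<subseteq> X \<times> X"
    using g[OF M] coarse_set_carrier[OF X L] by blast
  show "map_prod i i ` {(g (f L ` L) (f L x), x) |x. x \<in> L} \<in> \<E>"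
    by (rule coarse_subset[OF Z coarse_comp[OF Z conjunct2[OF g[OF M]] conjunct2[OF f[OF L]]]])
      blast
qed

section \<open>From coarse families to a coarse equivalence\<close>

lemma admissible_family_close:
  assumes "admissible_family \<E>X Y \<E>Y f" "L1 \<in> coarse_sets \<E>X" "L2 \<in> coarse_sets \<E>X"
  shows "{(f L1 x, f L2 x) |x. x \<in> L1 \<inter> L2} \<in> \<E>Y"
  by (rule bspec[OF bspec[OF conjunct2[OF assms(1)[unfolded admissible_family_def]] assms(2)] assms(3)])

lemma admissible_family_image:
  assumes "coarse_structure Y \<E>Y" "admissible_family \<E>X Y \<E>Y f" "L \<in> coarse_sets \<E>X"
  shows "f L ` L \<in> coarse_sets \<E>Y"
proof -
  have "{(f L x, f L x) |x. x \<in> L \<inter> L} \<in> \<E>Y"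
    by (rule admissible_family_close[OF assms(2,3,3)])
  moreover have "{(f L x, f L x) |x. x \<in> L \<inter> L} = Id_on (f L ` L)" by auto
  ultimately show ?thesis by (simp add: coarse_set_iff[OF assms(1)])
qed

text \<open>
  If \<open>(f \<times> f)(E)\<close> is controlled, so is \<open>(g \<times> g)(f \<times> f)(E)\<close>, and \<open>E\<close> is close to the latter. The
  index set that coarseness of \<open>g\<close> provides need not be \<open>f\<^sub>L(L)\<close>, so admissibility of \<open>g\<close> is
  needed to pass between the two members of the family.
\<close>

lemma pullback_eq_of_left_inverse:
  assumes X: "coarse_structure X \<E>X" and Y: "coarse_structure Y \<E>Y"
    and f: "coarse_family X \<E>X Y \<E>Y f" and g: "coarse_family Y \<E>Y X \<E>X g"
    and gf: "\<And>L. L \<in> coarse_sets \<E>X \<Longrightarrow> {(g (f L ` L) (f L x), x) |x. x \<in> L} \<in> \<E>X"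
  shows "pullback_coarse X \<E>X \<E>Y f = \<E>X"
proof
  show "\<E>X \<subseteq> pullback_coarse X \<E>X \<E>Y f" using f by (simp add: coarse_family_def)
  show "pullback_coarse X \<E>X \<E>Y f \<subseteq> \<E>X"
  proof
    fix E assume "E \<in> pullback_coarse X \<E>X \<E>Y f"
    then obtain L where L: "L \<in> coarse_sets \<E>X" "E \<subseteq> L \<times> L" "map_prod (f L) (f L) ` E \<in> \<E>Y"
      by (auto simp: pullback_coarse_def)
    define E' where "E' = map_prod (f L) (f L) ` E"
    have "E' \<in> pullback_coarse Y \<E>Y \<E>X g" using L(3) g by (auto simp: coarse_family_def E'_def)
    then obtain K where K: "K \<in> coarse_sets \<E>Y" "E' \<subseteq> K \<times> K" "map_prod (g K) (g K) ` E' \<in> \<E>X"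
      by (auto simp: pullback_coarse_def)
    define M where "M = f L ` L"
    have M: "M \<in> coarse_sets \<E>Y"
      unfolding M_def using f L(1) by (intro admissible_family_image[OF Y]) (auto simp: coarse_family_def)
    define N where "N = {(g M (f L x), x) |x. x \<in> L}"
    define C where "C = {(g M y, g K y) |y. y \<in> M \<inter> K}"
    have "N \<in> \<E>X" unfolding N_def M_def by (rule gf[OF L(1)])
    moreover have "C \<in> \<E>X"
      unfolding C_def using g M K(1)
      by (intro admissible_family_close[of \<E>Y X]) (auto simp: coarse_family_def)
    ultimately have "N\<inverse> O C O map_prod (g K) (g K) ` E' O C\<inverse> O N \<in> \<E>X"
      by (intro coarse_comp[OF X] coarse_converse[OF X] K(3))
    moreover have "E \<subseteq> N\<inverse> O C O map_prod (g K) (g K) ` E' O C\<inverse> O N"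
    proof clarify
      fix x y assume xy: "(x, y) \<in> E"
      then have *: "x \<in> L" "y \<in> L" using L(2) by auto
      have E': "(f L x, f L y) \<in> E'" using xy by (force simp: E'_def)
      then have "f L x \<in> K" "f L y \<in> K" using K(2) by auto
      with * have "(x, g M (f L x)) \<in> N\<inverse>" "(g M (f L y), y) \<in> N"
        "(g M (f L x), g K (f L x)) \<in> C" "(g K (f L y), g M (f L y)) \<in> C\<inverse>"
        by (auto simp: N_def C_def M_def)
      moreover have "(g K (f L x), g K (f L y)) \<in> map_prod (g K) (g K) ` E'"
        using E' by force
      ultimately show "(x, y) \<in> N\<inverse> O C O map_prod (g K) (g K) ` E' O C\<inverse> O N"
        by - (intro relcompI; assumption)
    qed
    ultimately show "E \<in> \<E>X" by (rule coarse_subset[OF X])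
  qed
qed

text \<open>
  The pullback of \<open>\<E>Y\<close> along the maps \<open>f\<^sub>L \<squnion> id\<close>. Using one index \<open>L\<close> for both coordinates lets
  a single image formula cover all four blocks of a relation on \<open>X \<squnion> Y\<close>.
\<close>

definition glued_coarse ::
    "'a set \<Rightarrow> ('a \<times> 'a) set set \<Rightarrow> 'b set \<Rightarrow> ('b \<times> 'b) set set \<Rightarrow> ('a set \<Rightarrow> 'a \<Rightarrow> 'b) \<Rightarrow>
     (('a + 'b) \<times> ('a + 'b)) set set" where
  "glued_coarse X \<E>X Y \<E>Y f =
     {E. E \<subseteq> (Inl ` X \<union> Inr ` Y) \<times> (Inl ` X \<union> Inr ` Y) \<and>
       (\<exists>L\<in>coarse_sets \<E>X. Field E \<subseteq> Inl ` L \<union> Inr ` Y \<and>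
          map_prod (case_sum (f L) id) (case_sum (f L) id) ` E \<in> \<E>Y)}"

text \<open>
  Enlarging the index set is harmless: on the smaller set, the old and the new member of the
  family are close. This allows two relations to be compared over a common index.
\<close>

lemma glued_coarse_enlarge:
  assumes Y: "coarse_structure Y \<E>Y" and f: "admissible_family \<E>X Y \<E>Y f"
    and LM: "L \<in> coarse_sets \<E>X" "M \<in> coarse_sets \<E>X" "L \<subseteq> M"
    and E: "Field E \<subseteq> Inl ` L \<union> Inr ` Y"
    "map_prod (case_sum (f L) id) (case_sum (f L) id) ` E \<in> \<E>Y"
  shows "map_prod (case_sum (f M) id) (case_sum (f M) id) ` E \<in> \<E>Y"
proof -
  let ?l = "case_sum (f L) id" and ?m = "case_sum (f M) id"
  let ?E = "map_prod ?l ?l ` E"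
  define A where "A = {(f M x, f L x) |x. x \<in> M \<inter> L} \<union> Id_on (Field ?E)"
  have "Id_on (Field ?E) \<in> \<E>Y"
    using Field_coarse_set[OF Y E(2)] by (simp add: coarse_set_iff[OF Y])
  then have "A \<in> \<E>Y"
    unfolding A_def by (intro coarse_Un[OF Y] admissible_family_close[OF f LM(2,1)])
  then have "A O ?E O A\<inverse> \<in> \<E>Y"
    by (intro coarse_comp[OF Y] coarse_converse[OF Y] E(2))
  moreover have "map_prod ?m ?m ` E \<subseteq> A O ?E O A\<inverse>"
  proof clarsimp
    fix p q assume pq: "(p, q) \<in> E"
    have lE: "(?l p, ?l q) \<in> ?E" using pq by force
    have A: "(?m r, ?l r) \<in> A" if "r \<in> Inl ` L \<union> Inr ` Y" "?l r \<in> Field ?E" for r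
      using that LM(3) by (auto simp: A_def)
    have "p \<in> Inl ` L \<union> Inr ` Y" "q \<in> Inl ` L \<union> Inr ` Y"
      using FieldI1[OF pq] FieldI2[OF pq] E(1) by blast+
    then have "(?m p, ?l p) \<in> A" "(?l q, ?m q) \<in> A\<inverse>"
      using FieldI1[OF lE] FieldI2[OF lE] A by blast+
    with lE show "(?m p, ?m q) \<in> A O ?E O A\<inverse>"
      by - (intro relcompI; assumption)
  qed
  ultimately show ?thesis by (rule coarse_subset[OF Y])
qed

lemma glued_coarse_structure:
  assumes X: "coarse_structure X \<E>X" and Y: "coarse_structure Y \<E>Y"
    and f: "admissible_family \<E>X Y \<E>Y f"
  shows "coarse_structure (Inl ` X \<union> Inr ` Y) (glued_coarse X \<E>X Y \<E>Y f)"
    (is "coarse_structure ?Z ?\<E>")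
proof -
  let ?h = "\<lambda>L. case_sum (f L) id"
  have common: "\<exists>L\<in>coarse_sets \<E>X. Field E \<subseteq> Inl ` L \<union> Inr ` Y \<and> Field F \<subseteq> Inl ` L \<union> Inr ` Y \<and>
      map_prod (?h L) (?h L) ` E \<in> \<E>Y \<and> map_prod (?h L) (?h L) ` F \<in> \<E>Y"
    if EF: "E \<in> ?\<E>" "F \<in> ?\<E>" for E F
  proof -
    obtain L M where LM: "L \<in> coarse_sets \<E>X" "Field E \<subseteq> Inl ` L \<union> Inr ` Y"
      "map_prod (?h L) (?h L) ` E \<in> \<E>Y"
      "M \<in> coarse_sets \<E>X" "Field F \<subseteq> Inl ` M \<union> Inr ` Y"
      "map_prod (?h M) (?h M) ` F \<in> \<E>Y"
      using EF unfolding glued_coarse_def by blast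
    have U: "L \<union> M \<in> coarse_sets \<E>X" by (rule coarse_set_Un[OF X LM(1,4)])
    show ?thesis
      using LM(2,5) glued_coarse_enlarge[OF Y f LM(1) U _ LM(2,3)]
        glued_coarse_enlarge[OF Y f LM(4) U _ LM(5,6)]
      by (intro bexI[OF _ U]) blast
  qed
  show ?thesis
    unfolding coarse_structure_def
  proof (intro conjI ballI allI impI)
    show "?\<E> \<subseteq> Pow (?Z \<times> ?Z)" by (auto simp: glued_coarse_def)
  next
    fix E assume "E \<in> ?\<E>"
    then obtain L where L: "E \<subseteq> ?Z \<times> ?Z" "L \<in> coarse_sets \<E>X" "Field E \<subseteq> Inl ` L \<union> Inr ` Y"
      "map_prod (?h L) (?h L) ` E \<in> \<E>Y"
      unfolding glued_coarse_def by blast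
    have "map_prod (?h L) (?h L) ` (E\<inverse>) = (map_prod (?h L) (?h L) ` E)\<inverse>" by force
    then have "map_prod (?h L) (?h L) ` (E\<inverse>) \<in> \<E>Y"
      using coarse_converse[OF Y L(4)] by simp
    then show "E\<inverse> \<in> ?\<E>"
      using L(1-3) unfolding glued_coarse_def by (auto simp: Field_converse)
  next
    fix E F assume EF: "E \<in> ?\<E>" "F \<in> ?\<E>"
    obtain L where L: "L \<in> coarse_sets \<E>X" "Field E \<subseteq> Inl ` L \<union> Inr ` Y"
      "Field F \<subseteq> Inl ` L \<union> Inr ` Y"
      "map_prod (?h L) (?h L) ` E \<in> \<E>Y" "map_prod (?h L) (?h L) ` F \<in> \<E>Y"
      using common[OF EF] by blast
    have Z: "E \<subseteq> ?Z \<times> ?Z" "F \<subseteq> ?Z \<times> ?Z" using EF by (auto simp: glued_coarse_def)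
    have "map_prod (?h L) (?h L) ` (E O F) \<in> \<E>Y"
      by (rule coarse_subset[OF Y coarse_comp[OF Y L(4,5)]]) force
    moreover have "Field (E O F) \<subseteq> Field E \<union> Field F" by (auto simp: Field_def)
    moreover have "E O F \<subseteq> ?Z \<times> ?Z" using Z by blast
    ultimately show "E O F \<in> ?\<E>"
      unfolding glued_coarse_def using L(1-3) by blast
    have "map_prod (?h L) (?h L) ` (E \<union> F) \<in> \<E>Y"
      using coarse_Un[OF Y L(4,5)] by (simp add: image_Un)
    then show "E \<union> F \<in> ?\<E>"
      unfolding glued_coarse_def using L(1-3) Z by (auto simp del: Un_iff intro!: bexI[of _ L])
  next
    fix E F assume E: "E \<in> ?\<E>" "F \<subseteq> E"
    then obtain L where L: "E \<subseteq> ?Z \<times> ?Z" "L \<in> coarse_sets \<E>X" "Field E \<subseteq> Inl ` L \<union> Inr ` Y"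
      "map_prod (?h L) (?h L) ` E \<in> \<E>Y"
      unfolding glued_coarse_def by blast
    have "map_prod (?h L) (?h L) ` F \<in> \<E>Y"
      using coarse_subset[OF Y L(4)] E(2) by (simp add: image_mono)
    then show "F \<in> ?\<E>"
      unfolding glued_coarse_def using L(1-3) mono_Field[OF E(2)] E(2) by blast
  next
    fix F assume F: "finite F \<and> F \<subseteq> ?Z \<times> ?Z"
    \<comment> \<open>finite sets are coarse, so the points of \<open>X\<close> that occur in \<open>F\<close> serve as the index\<close>
    define L where "L = Inl -` Field F"
    have FZ: "Field F \<subseteq> ?Z" using F by (auto simp: Field_def)
    have "finite (Field F)" using F by (simp add: Field_def finite_Domain finite_Range)
    then have L: "L \<in> coarse_sets \<E>X"
      unfolding L_def using FZ by (intro coarse_set_finite[OF X] finite_vimageI) auto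
    have FL: "Field F \<subseteq> Inl ` L \<union> Inr ` Y" using FZ by (auto simp: L_def)
    have "?h L ` Field F \<subseteq> Y"
      using FL f L by (fastforce simp: admissible_family_def)
    moreover have "F \<subseteq> Field F \<times> Field F" by (auto simp: Field_def)
    ultimately have "map_prod (?h L) (?h L) ` F \<subseteq> Y \<times> Y" by fastforce
    then have "map_prod (?h L) (?h L) ` F \<in> \<E>Y"
      using F by (intro coarse_finite[OF Y]) auto
    then show "F \<in> ?\<E>"
      unfolding glued_coarse_def using F L FL by blast
  qed
qed

lemma glued_coarse_Inr_iff:
  assumes X: "coarse_structure X \<E>X" and Y: "coarse_structure Y \<E>Y"
  shows "E \<in> \<E>Y \<longleftrightarrow> E \<subseteq> Y \<times> Y \<and> map_prod Inr Inr ` E \<in> glued_coarse X \<E>X Y \<E>Y f"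
proof -
  have empty: "{} \<in> coarse_sets \<E>X" by (rule coarse_set_finite[OF X]) auto
  have image: "map_prod (case_sum (f L) id) (case_sum (f L) id) ` map_prod Inr Inr ` E = E" for L
    by force
  show ?thesis
  proof
    assume E: "E \<in> \<E>Y"
    then have EY: "E \<subseteq> Y \<times> Y" by (rule coarse_carrier[OF Y])
    then have "map_prod Inr Inr ` E \<subseteq> (Inl ` X \<union> Inr ` Y) \<times> (Inl ` X \<union> Inr ` Y)"
      "Field (map_prod Inr Inr ` E) \<subseteq> Inl ` {} \<union> Inr ` Y"
      by (auto simp: Field_def)
    with E EY empty show "E \<subseteq> Y \<times> Y \<and> map_prod Inr Inr ` E \<in> glued_coarse X \<E>X Y \<E>Y f"
      unfolding glued_coarse_def by (intro conjI CollectI bexI[OF _ empty]) (simp_all only: image)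
  next
    assume "E \<subseteq> Y \<times> Y \<and> map_prod Inr Inr ` E \<in> glued_coarse X \<E>X Y \<E>Y f"
    then show "E \<in> \<E>Y" by (auto simp: glued_coarse_def image)
  qed
qed

lemma glued_coarse_Inl_iff:
  assumes X: "coarse_structure X \<E>X"
  shows "E \<in> pullback_coarse X \<E>X \<E>Y f \<longleftrightarrow>
    E \<subseteq> X \<times> X \<and> map_prod Inl Inl ` E \<in> glued_coarse X \<E>X Y \<E>Y f"
proof -
  have "map_prod (case_sum (f L) id) (case_sum (f L) id) ` map_prod Inl Inl ` E =
      map_prod (f L) (f L) ` E" for L
    by force
  moreover have "Field (map_prod Inl Inl ` E) \<subseteq> Inl ` L \<union> Inr ` Y \<longleftrightarrow> E \<subseteq> L \<times> L"
    for L :: "'a set"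
    by (fastforce simp: Field_def)
  moreover have "map_prod Inl Inl ` E \<subseteq> (Inl ` X \<union> Inr ` Y) \<times> (Inl ` X \<union> Inr ` Y)" if "E \<subseteq> X \<times> X"
    using that by auto
  ultimately show ?thesis
    by (auto simp: glued_coarse_def pullback_coarse_def)
qed

lemma coarse_set_of_sum:
  assumes Z: "coarse_structure (Inl ` X \<union> Inr ` Y) \<E>" and K: "K \<in> coarse_sets \<E>"
    and iX: "\<And>E. E \<in> \<E>X \<longleftrightarrow> E \<subseteq> X \<times> X \<and> map_prod Inl Inl ` E \<in> \<E>"
    and iY: "\<And>E. E \<in> \<E>Y \<longleftrightarrow> E \<subseteq> Y \<times> Y \<and> map_prod Inr Inr ` E \<in> \<E>"
    and X: "coarse_structure X \<E>X" and Y: "coarse_structure Y \<E>Y"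
  shows "\<exists>L\<in>coarse_sets \<E>X. \<exists>M\<in>coarse_sets \<E>Y. K = Inl ` L \<union> Inr ` M"
proof (intro bexI)
  have KZ: "K \<subseteq> Inl ` X \<union> Inr ` Y" by (rule coarse_set_carrier[OF Z K])
  have K': "Id_on K \<in> \<E>" using K by (simp add: coarse_set_iff[OF Z])
  show "Inl -` K \<in> coarse_sets \<E>X"
    unfolding coarse_set_iff[OF X] iX using KZ by (auto intro: coarse_subset[OF Z K'])
  show "Inr -` K \<in> coarse_sets \<E>Y"
    unfolding coarse_set_iff[OF Y] iY using KZ by (auto intro: coarse_subset[OF Z K'])
  show "K = Inl ` (Inl -` K) \<union> Inr ` (Inr -` K)" using KZ by auto
qed

text \<open>
  A coarse set of the glued structure splits as \<open>L \<squnion> M\<close>. Over \<open>Y\<close> it is covered by the graph of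
  \<open>f\<^sub>L\<close> and the diagonal of \<open>M\<close>, over \<open>X\<close> by the graph of \<open>g\<^sub>M\<close> and the diagonal of \<open>L\<close>. The graph of \<open>g\<^sub>M\<close>
  is controlled because \<open>f\<close>, indexed by \<open>g\<^sub>M(M)\<close>, turns it into the closeness of \<open>f \<circ> g\<close> to the
  identity.
\<close>

lemma glued_coarse_equivalence:
  assumes X: "coarse_structure X \<E>X" and Y: "coarse_structure Y \<E>Y" and ne: "X = {} \<longleftrightarrow> Y = {}"
    and f: "coarse_family X \<E>X Y \<E>Y f" and g: "coarse_family Y \<E>Y X \<E>X g"
    and gf: "\<And>L. L \<in> coarse_sets \<E>X \<Longrightarrow> {(g (f L ` L) (f L x), x) |x. x \<in> L} \<in> \<E>X"
    and fg: "\<And>L. L \<in> coarse_sets \<E>Y \<Longrightarrow> {(f (g L ` L) (g L y), y) |y. y \<in> L} \<in> \<E>Y"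
  shows "coarse_equivalence X \<E>X Y \<E>Y (glued_coarse X \<E>X Y \<E>Y f)"
proof -
  define \<E> where "\<E> = glued_coarse X \<E>X Y \<E>Y f"
  define Z :: "('a + 'b) set" where "Z = Inl ` X \<union> Inr ` Y"
  have fa: "admissible_family \<E>X Y \<E>Y f" and ga: "admissible_family \<E>Y X \<E>X g"
    using f g by (auto simp: coarse_family_def)
  have Z: "coarse_structure Z \<E>"
    unfolding Z_def \<E>_def by (rule glued_coarse_structure[OF X Y fa])
  have iX: "E \<in> \<E>X \<longleftrightarrow> E \<subseteq> X \<times> X \<and> map_prod Inl Inl ` E \<in> \<E>" for E
    using glued_coarse_Inl_iff[OF X, of E \<E>Y f Y] pullback_eq_of_left_inverse[OF X Y f g gf]
    by (simp add: \<E>_def)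
  have iY: "E \<in> \<E>Y \<longleftrightarrow> E \<subseteq> Y \<times> Y \<and> map_prod Inr Inr ` E \<in> \<E>" for E
    unfolding \<E>_def by (rule glued_coarse_Inr_iff[OF X Y])
  have resX: "restrict_coarse \<E> (Inl ` X) (Inl ` X) = transport_coarse Inl \<E>X"
    using iX coarse_carrier[OF X] by (subst restrict_eq_transport_iff[OF inj_Inl Z]) auto
  have resY: "restrict_coarse \<E> (Inr ` Y) (Inr ` Y) = transport_coarse Inr \<E>Y"
    using iY coarse_carrier[OF Y] by (subst restrict_eq_transport_iff[OF inj_Inr Z]) auto
  have split: "\<exists>L\<in>coarse_sets \<E>X. \<exists>M\<in>coarse_sets \<E>Y. K = Inl ` L \<union> Inr ` M"
    if "K \<in> coarse_sets \<E>" for K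
    using coarse_set_of_sum[OF Z[unfolded Z_def] that iX iY X Y] .
  \<comment> \<open>a relation from \<open>Y\<close> to \<open>X\<close> is controlled if moving its second coordinate to \<open>Y\<close> along \<open>f\<^sub>L\<close> makes it so\<close>
  have cross: "{(Inr y, Inl x) |x y. (y, x) \<in> R} \<in> \<E>"
    if "L \<in> coarse_sets \<E>X" "R \<subseteq> Y \<times> L" "{(y, f L x) |x y. (y, x) \<in> R} \<in> \<E>Y" for L R
  proof -
    let ?R = "{(Inr y, Inl x) |x y. (y, x) \<in> R}"
    have "map_prod (case_sum (f L) id) (case_sum (f L) id) ` ?R = {(y, f L x) |x y. (y, x) \<in> R}"
      by (auto simp: image_iff) (metis Pair_inject id_apply map_prod_simp sum.case)+
    moreover have "?R \<subseteq> Z \<times> Z"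
      using that(2) coarse_set_carrier[OF X that(1)] by (auto simp: Z_def)
    moreover have "Field ?R \<subseteq> Inl ` L \<union> Inr ` Y"
      using that(2) by (auto simp: Field_def)
    ultimately show ?thesis
      unfolding \<E>_def glued_coarse_def Z_def using that(3)
      by (intro CollectI conjI bexI[OF _ that(1)]) simp_all
  qed
  have graph_f: "{(Inr (f L x), Inl x) |x. x \<in> L} \<in> \<E>" if L: "L \<in> coarse_sets \<E>X" for L
  proof -
    have "{(y, f L x) |x y. (y, x) \<in> {(f L x, x) |x. x \<in> L}} = {(f L x, f L x) |x. x \<in> L \<inter> L}"
      by auto
    then have "{(Inr y, Inl x) |x y. (y, x) \<in> {(f L x, x) |x. x \<in> L}} \<in> \<E>"
      using admissible_family_close[OF fa L L] fa L
      by (intro cross[OF L]) (auto simp: admissible_family_def)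
    then show ?thesis by (rule coarse_subset[OF Z]) auto
  qed
  have graph_g: "{(Inl (g M y), Inr y) |y. y \<in> M} \<in> \<E>" if M: "M \<in> coarse_sets \<E>Y" for M
  proof -
    let ?L = "g M ` M"
    have L: "?L \<in> coarse_sets \<E>X" by (rule admissible_family_image[OF X ga M])
    have "{(y, f ?L x) |x y. (y, x) \<in> {(y, g M y) |y. y \<in> M}} = {(f ?L (g M y), y) |y. y \<in> M}\<inverse>"
      by auto
    then have "{(Inr y, Inl x) |x y. (y, x) \<in> {(y, g M y) |y. y \<in> M}} \<in> \<E>"
      using coarse_converse[OF Y fg[OF M]] coarse_set_carrier[OF Y M] by (intro cross[OF L]) auto
    from coarse_converse[OF Z this] show ?thesis by (rule coarse_subset[OF Z]) auto
  qed
  have diag_X: "Id_on (Inl ` L) \<in> \<E>" if "L \<in> coarse_sets \<E>X" for L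
  proof -
    have "map_prod Inl Inl ` Id_on L \<in> \<E>" using that iX coarse_set_iff[OF X] by blast
    then show ?thesis by (rule coarse_subset[OF Z]) force
  qed
  have diag_Y: "Id_on (Inr ` M) \<in> \<E>" if "M \<in> coarse_sets \<E>Y" for M
  proof -
    have "map_prod Inr Inr ` Id_on M \<in> \<E>" using that iY coarse_set_iff[OF Y] by blast
    then show ?thesis by (rule coarse_subset[OF Z]) force
  qed
  have "\<exists>H\<in>\<E>. Domain H \<subseteq> Inr ` Y \<and> K \<subseteq> Range H" if K: "K \<in> coarse_sets \<E>" for K
  proof -
    obtain L M where LM: "L \<in> coarse_sets \<E>X" "M \<in> coarse_sets \<E>Y" "K = Inl ` L \<union> Inr ` M"
      using split[OF K] by blast
    have "f L ` L \<subseteq> Y" "M \<subseteq> Y"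
      using fa LM coarse_set_carrier[OF Y] by (auto simp: admissible_family_def)
    then show ?thesis
      using LM(3) by (intro bexI[OF _ coarse_Un[OF Z graph_f[OF LM(1)] diag_Y[OF LM(2)]]]) auto
  qed
  then have genY: "\<E> = generated_coarse_structure Z (restrict_coarse \<E> (Inr ` Y) Z)"
    using ne by (subst generated_by_restriction_iff[OF Z]) (auto simp: Z_def)
  have "\<exists>H\<in>\<E>. Domain H \<subseteq> Inl ` X \<and> K \<subseteq> Range H" if K: "K \<in> coarse_sets \<E>" for K
  proof -
    obtain L M where LM: "L \<in> coarse_sets \<E>X" "M \<in> coarse_sets \<E>Y" "K = Inl ` L \<union> Inr ` M"
      using split[OF K] by blast
    have "g M ` M \<subseteq> X" "L \<subseteq> X"
      using ga LM coarse_set_carrier[OF X] by (auto simp: admissible_family_def)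
    then show ?thesis
      using LM(3) by (intro bexI[OF _ coarse_Un[OF Z graph_g[OF LM(2)] diag_X[OF LM(1)]]]) auto
  qed
  then have genX: "\<E> = generated_coarse_structure Z (restrict_coarse \<E> (Inl ` X) Z)"
    using ne by (subst generated_by_restriction_iff[OF Z]) (auto simp: Z_def)
  have "Inr ` Y \<union> Inl ` X = Z" "Inl ` X \<inter> Inr ` Y = {}" "Inr ` Y \<inter> Inl ` X = {}"
    by (auto simp: Z_def)
  then show ?thesis
    unfolding coarse_equivalence_def coarse_correspondence_def \<E>_def[symmetric]
    using Z genX genY resX resY by (simp add: Z_def[symmetric])
qed

section \<open>The characterization\<close>

theorem propositionD:
  fixes X :: "'a set" and \<E>X :: "('a \<times> 'a) set set"
    and Y :: "'b set" and \<E>Y :: "('b \<times> 'b) set set"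
  assumes "coarse_structure X \<E>X" and "coarse_structure Y \<E>Y"
    and "X = {} \<longleftrightarrow> Y = {}"
  shows "coarsely_equivalent X \<E>X Y \<E>Y \<longleftrightarrow>
    (\<exists>f g. coarse_family X \<E>X Y \<E>Y f \<and> coarse_family Y \<E>Y X \<E>X g \<and>
       (\<forall>L\<in>coarse_sets \<E>X. {(g (f L ` L) (f L x), x) |x. x \<in> L} \<in> \<E>X) \<and>
       (\<forall>L\<in>coarse_sets \<E>Y. {(f (g L ` L) (g L y), y) |y. y \<in> L} \<in> \<E>Y))"
    (is "_ \<longleftrightarrow> (\<exists>f g. ?inverse_families f g)")
proof
  note X = assms(1) and Y = assms(2)
  assume "coarsely_equivalent X \<E>X Y \<E>Y"
  then obtain \<E> where
    XY: "coarse_correspondence (Inl ` X) (transport_coarse Inl \<E>X) (Inr ` Y) (transport_coarse Inr \<E>Y) \<E>"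
    and YX: "coarse_correspondence (Inr ` Y) (transport_coarse Inr \<E>Y) (Inl ` X) (transport_coarse Inl \<E>X) \<E>"
    by (auto simp: coarsely_equivalent_def coarse_equivalence_def)
  have Z: "coarse_structure (Inl ` X \<union> Inr ` Y) \<E>"
    using XY by (simp add: coarse_correspondence_def)
  have iX: "E \<in> \<E>X \<longleftrightarrow> E \<subseteq> X \<times> X \<and> map_prod Inl Inl ` E \<in> \<E>" for E
    using YX restrict_eq_transport_iff[OF inj_Inl Z, of \<E>X X] coarse_carrier[OF X]
    unfolding coarse_correspondence_def by blast
  have iY: "E \<in> \<E>Y \<longleftrightarrow> E \<subseteq> Y \<times> Y \<and> map_prod Inr Inr ` E \<in> \<E>" for E
    using XY restrict_eq_transport_iff[OF inj_Inr Z, of \<E>Y Y] coarse_carrier[OF Y]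
    unfolding coarse_correspondence_def by blast
  obtain f where f: "\<And>L. L \<in> coarse_sets \<E>X \<Longrightarrow>
      f L ` L \<subseteq> Y \<and> {(Inr (f L x), Inl x) |x. x \<in> L} \<in> \<E>"
    using correspondence_selects_family[OF X XY] assms(3) by blast
  obtain g where g: "\<And>L. L \<in> coarse_sets \<E>Y \<Longrightarrow>
      g L ` L \<subseteq> X \<and> {(Inl (g L y), Inr y) |y. y \<in> L} \<in> \<E>"
    using correspondence_selects_family[OF Y YX] assms(3) by blast
  note inX = iX[THEN iffD1, THEN conjunct2] and outX = iX[THEN iffD2, OF conjI]
  note inY = iY[THEN iffD1, THEN conjunct2] and outY = iY[THEN iffD2, OF conjI]
  have "coarse_family X \<E>X Y \<E>Y f"
    by (rule selected_family_coarse[OF X Z inX outY conjunct1[OF f] conjunct2[OF f]])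
  moreover have "coarse_family Y \<E>Y X \<E>X g"
    by (rule selected_family_coarse[OF Y Z inY outX conjunct1[OF g] conjunct2[OF g]])
  moreover have "{(g (f L ` L) (f L x), x) |x. x \<in> L} \<in> \<E>X" if "L \<in> coarse_sets \<E>X" for L
    by (rule selected_families_inverse[OF X Y Z outX outY f g that])
  moreover have "{(f (g L ` L) (g L y), y) |y. y \<in> L} \<in> \<E>Y" if "L \<in> coarse_sets \<E>Y" for L
    by (rule selected_families_inverse[OF Y X Z outY outX g f that])
  ultimately show "\<exists>f g. ?inverse_families f g" by blast
next
  assume "\<exists>f g. ?inverse_families f g"
  then show "coarsely_equivalent X \<E>X Y \<E>Y"
    unfolding coarsely_equivalent_def using glued_coarse_equivalence[OF assms] by blast
qed

end
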